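(* Suppose $(\mathfrak X^\dagger,\mathcal V^\dagger)$, with surjective summary maps $\sigma_t^\dagger:\mathcal H_t\to\mathcal X_t^\dagger$, $t\in[T+1]$, factorizes a compatible utility system $\mathbf U$ for the grand preference $\mathcal P$, and that separated Markov feasibility and separated DP regularity hold (defined in the context). Then the value functions $J_t^\dagger(\xi_t)=\sup_{\pi^\dagger\in\Pi^\dagger}U_t^{\dagger\pi^\dagger}(\xi_t)$, $t\in[T]$, satisfy $$J_T^\dagger(\xi_T)=\max_{c\in\mathcal A_T^\dagger(\xi_T)}U_{T+1}^\dagger(\Gamma_T^\dagger(\xi_T,c,\star)),\quad\forall\xi_T\in\mathcal X_T^\dagger,$$ $$J_t^\dagger(\xi_t)=\max_{c\in\mathcal A_t^\dagger(\xi_t)}W_t^\dagger\bigl(s_t,z_t,c,M_t^\dagger(s_t,y_t,\tilde j_{t+1}^\dagger(\xi_t,c))\bigr),\quad\forall\xi_t=(s_t,y_t,z_t)\in\mathcal X_t^\dagger,\ t\in[T-1],$$ where $[\tilde j_{t+1}^\dagger(\xi_t,c)](s)=J_{t+1}^\dagger(\Gamma_t^\dagger(\xi_t,c,s))$ for $s\in\mathcal S$. The maxima are attained. There exists a single $\bar\pi^\dagger\in\Pi^\dagger$ which attains the displayed maxima at every state and time, and satisfies $U_t^{\dagger\bar\pi^\dagger}(\xi_t)=J_t^\dagger(\xi_t)$ for every $\xi_t\in\mathcal X_t^\dagger$ and $t\in[T]$. Moreover, each $J_t^\dagger$ is continuous.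
   Context: **Primitives.** For an integer $n\ge 0$, $[n]=\{0,1,\dots,n\}$. $T\ge 1$ is an integer horizon. $\mathcal S$ is a finite nonempty set (discrete topology); $\mathcal S_0=\{\bar s_0\}$ is a singleton, $\mathcal S_t=\mathcal S$ for $1\le t\le T$, $\mathcal S_{T+1}=\{\star\}$. $\mathcal C=[0,\bar c]\subset\mathbb R_{\ge 0}$ is a compact interval. Histories: $\mathcal H_0=\{\bar s_0\}$, $\mathcal H_t=\mathcal H_{t-1}\times\mathcal C\times\mathcal S_t$ for $1\le t\le T$, $\mathcal H_{T+1}=\mathcal H_T\times\mathcal C$, with product topologies (compact metrizable). Extension maps $\iota_t:\mathcal H_t\times\mathcal C\times\mathcal S_{t+1}\to\mathcal H_{t+1}$: $\iota_t(h_t,c,s)=(h_t,c,s)$ for $t\in[T-1]$, $\iota_T(h_T,c,\star)=(h_T,c)$. Physical-state projections $\sigma^s_t:\mathcal H_t\to\mathcal S_t$: $\sigma_t^s(h_t)$ is the last state $s_t$ of $h_t$ for $t\in[T]$, and $\sigma^s_{T+1}\equiv\star$. Plans: $\mathcal F_{T+1}=\{\emptyset\}$ and $\mathcal F_t=\mathcal C\times(\mathcal F_{t+1})^{\mathcal S}$ for $t\in[T]$ (product topology); $\mathcal F_T$ is identified with $\mathcal C$. For $t\in[T-1]$ a plan is written $f=(c,f_+)$ with $c\in\mathcal C$, $f_+:\mathcal S\to\mathcal F_{t+1}$. $\mathcal L=\mathbb R^{\mathcal S}$ with sup norm and pointwise order; $\mathbf v\in\mathcal L$ is the constant vector with value $v$.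 **Preferences.** A grand preference is $\mathcal P=(\{\succeq_{(t)}\}_{t=0}^T,V_{T+1})$ with $\succeq_{(t)}$ a binary relation on $\mathcal H_t\times\mathcal F_t$ and $V_{T+1}:\mathcal H_{T+1}\to\mathbb R$ continuous. A utility system is $\mathbf U=\{U_t\}_{t=0}^{T+1}$ with $U_t:\mathcal H_t\times\mathcal F_t\to\mathbb R$ ($t\in[T]$) and $U_{T+1}:\mathcal H_{T+1}\to\mathbb R$ continuous. It is compatible with $\mathcal P$ if $U_{T+1}=V_{T+1}$; $U_T(h_T,c)=U_{T+1}(\iota_T(h_T,c,\star))$; and for all $t\in[T]$, $U_t(h_t,f)\ge U_t(h_t',g)\iff(h_t,f)\succeq_{(t)}(h_t',g)$. **SPA-state systems.** An SPA-state system is $\mathfrak X^\dagger=(\{\mathcal Y_t\}_{t=0}^{T+1},\{\mathcal Z_t\}_{t=0}^{T+1},\{\mathcal X_t^\dagger\}_{t=0}^{T+1},\{\varsigma_t^\dagger\}_{t=0}^{T+1},\{\Gamma_t^\dagger\}_{t=0}^{T})$ with $\mathcal Y_t,\mathcal Z_t$ Hausdorff spaces, $\mathcal X_t^\dagger\subseteq\mathcal S_t\times\mathcal Y_t\times\mathcal Z_t$ a nonempty compact metrizable subspace with elements $\xi_t=(s_t,y_t,z_t)$, $\varsigma_t^\dagger(\xi_t)=s_t$, and $\Gamma_t^\dagger:\mathcal X_t^\dagger\times\mathcal C\times\mathcal S_{t+1}\to\mathcal X_{t+1}^\dagger$ continuous with $\varsigma_{t+1}^\dagger(\Gamma_t^\dagger(\xi_t,c,s'))=s'$.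 Let $\mathcal X_t^{\dagger,y}\subseteq\mathcal S_t\times\mathcal Y_t$ and $\mathcal X_t^{\dagger,z}\subseteq\mathcal S_t\times\mathcal Z_t$ be the images of $\mathcal X_t^\dagger$ under $\xi_t\mapsto(s_t,y_t)$ and $\xi_t\mapsto(s_t,z_t)$. An SPA recursive structure is $\mathcal V^\dagger=(\{W_t^\dagger\}_{t=0}^{T-1},\{M_t^\dagger\}_{t=0}^{T-1},V_{T+1}^\dagger)$ with $W_t^\dagger:\mathcal X_t^{\dagger,z}\times\mathcal C\times\mathbb R\to\mathbb R$ jointly continuous and nondecreasing in its last argument; $M_t^\dagger:\mathcal X_t^{\dagger,y}\times\mathcal L\to\mathbb R$ jointly continuous, monotone in $\tilde u$, with $M_t^\dagger(s,y,\mathbf v)=v$ for all $v\in\mathbb R$; $V_{T+1}^\dagger:\mathcal X_{T+1}^\dagger\to\mathbb R$ continuous. It generates $U_{T+1}^\dagger=V_{T+1}^\dagger$, $U_T^\dagger(\xi_T,c)=U_{T+1}^\dagger(\Gamma_T^\dagger(\xi_T,c,\star))$, and for $t\in[T-1]$, $f=(c,f_+)$, $U_t^\dagger(\xi_t,f)=W_t^\dagger(s_t,z_t,c,M_t^\dagger(s_t,y_t,\tilde u^\dagger_{t+1}(\xi_t,f)))$ with $[\tilde u^\dagger_{t+1}(\xi_t,f)](s)=U_{t+1}^\dagger(\Gamma_t^\dagger(\xi_t,c,s),f_+(s))$. **Factorization.** $(\mathfrak X^\dagger,\mathcal V^\dagger)$ factorizes $\mathbf U$ if for all $t\in[T+1]$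 there are continuous $\sigma_t^y:\mathcal H_t\to\mathcal Y_t$, $\sigma_t^z:\mathcal H_t\to\mathcal Z_t$ such that $\sigma_t^\dagger:=(\sigma_t^s,\sigma_t^y,\sigma_t^z)$ takes values in $\mathcal X_t^\dagger$, $U_{T+1}=U_{T+1}^\dagger\circ\sigma_{T+1}^\dagger$, $U_t(h_t,f)=U_t^\dagger(\sigma_t^\dagger(h_t),f)$ ($t\in[T]$), and $\sigma_{t+1}^\dagger(\iota_t(h_t,c,s))=\Gamma_t^\dagger(\sigma_t^\dagger(h_t),c,s)$ for all $h_t,c,s\in\mathcal S_{t+1}$, $t\in[T]$. **Feasibility and policies.** For $t\in[T]$, $\mathcal A_t:\mathcal H_t\rightrightarrows\mathcal C$ is the correspondence of feasible consumption levels. Separated Markov feasibility: if $\sigma_t^\dagger(h_t)=\sigma_t^\dagger(h_t')$ then $\mathcal A_t(h_t)=\mathcal A_t(h_t')$; write $\mathcal A_t^\dagger(\xi_t)=\mathcal A_t(h_t)$ for any $h_t\in(\sigma_t^\dagger)^{-1}(\xi_t)$. Separated DP regularity: for all $t\in[T]$, $\mathcal A_t^\dagger:\mathcal X_t^\dagger\rightrightarrows\mathcal C$ has nonempty compact values and is continuous (upper and lower hemicontinuous). $\Pi^\dagger$ is the set of SPA Markov policies $\pi^\dagger=\{\pi_t^\dagger\}_{t=0}^T$, arbitrary functions $\pi_t^\dagger:\mathcal X_t^\dagger\to\mathcal C$ with $\pi_t^\dagger(\xi_t)\in\mathcal A_t^\dagger(\xi_t)$. Policy utilities: $U_{T+1}^{\dagger\pi^\dagger}=U_{T+1}^\dagger$,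 $U_T^{\dagger\pi^\dagger}(\xi_T)=U_{T+1}^{\dagger\pi^\dagger}(\Gamma_T^\dagger(\xi_T,\pi_T^\dagger(\xi_T),\star))$, and for $t\in[T-1]$, $U_t^{\dagger\pi^\dagger}(\xi_t)=W_t^\dagger(s_t,z_t,\pi_t^\dagger(\xi_t),M_t^\dagger(s_t,y_t,\tilde u_{t+1}^{\dagger\pi^\dagger}(\xi_t,\pi_t^\dagger(\xi_t))))$ with $[\tilde u_{t+1}^{\dagger\pi^\dagger}(\xi_t,c)](s)=U_{t+1}^{\dagger\pi^\dagger}(\Gamma_t^\dagger(\xi_t,c,s))$ for $s\in\mathcal S$. *)

theory Defs
  imports "HOL-Analysis.Analysis"
begin

definition transport_topology :: "('a \<Rightarrow> 'b) \<Rightarrow> 'a topology \<Rightarrow> 'b topology" where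
  "transport_topology k X = pullback_topology (k ` topspace X) (inv_into (topspace X) k) X"

lemma homeomorphic_map_transport_topology:
  assumes "inj_on k (topspace X)"
  shows "homeomorphic_map X (transport_topology k X) k"
proof -
  let ?j = "inv_into (topspace X) k"
  have ts: "topspace (transport_topology k X) = k ` topspace X"
    by (auto simp: transport_topology_def topspace_pullback_topology inv_into_into)
  have op: "openin (transport_topology k X) V \<longleftrightarrow> (\<exists>U. openin X U \<and> V = k ` U)" for V
  proof -
    have "?j -` U \<inter> k ` topspace X = k ` U" if "openin X U" for U
      using openin_subset[OF that] assms by (force simp: inv_into_f_f)
    then show ?thesis
      unfolding transport_topology_def openin_pullback_topology by metis
  qed
  have "continuous_map X (transport_topology k X) k"
    unfolding continuous_map_def
  proof (intro conjI allI impI)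
    show "k \<in> topspace X \<rightarrow> topspace (transport_topology k X)" using ts by auto
    fix V assume "openin (transport_topology k X) V"
    then obtain U where U: "openin X U" "V = k ` U" using op by auto
    then have "{x \<in> topspace X. k x \<in> V} = U"
      using openin_subset[OF U(1)] assms by (auto dest: inj_onD)
    then show "openin X {x \<in> topspace X. k x \<in> V}" using U by simp
  qed
  moreover have "open_map X (transport_topology k X) k"
    unfolding open_map_def using op by blast
  ultimately show ?thesis
    using assms ts by (simp add: bijective_open_imp_homeomorphic_map)
qed

record 's primitives =
  horizon :: nat
  states :: "'s set"
  init_state :: 's
  end_state :: 's
  cmax :: real

definition valid_primitives :: "'s primitives \<Rightarrow> bool" where
  "valid_primitives E \<longleftrightarrow>
     horizon E \<ge> 1 \<and> finite (states E) \<and> states E \<noteq> {} \<and> cmax E \<ge> 0"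

definition states_at :: "'s primitives \<Rightarrow> nat \<Rightarrow> 's set" where
  "states_at E t =
     (if t = 0 then {init_state E} else if t \<le> horizon E then states E else {end_state E})"

definition cons_set :: "'s primitives \<Rightarrow> real set" where
  "cons_set E = {0..cmax E}"

definition cons_space :: "'s primitives \<Rightarrow> real topology" where
  "cons_space E = top_of_set (cons_set E)"

text \<open>Histories are iterated tuples: \<open>HStep h c s\<close> is the tuple \<open>(h, c, s)\<close> and \<open>HEnd h c\<close>
  the tuple \<open>(h, c)\<close>. The topologies make the constructors homeomorphisms from the products.\<close>

datatype 's hist = HInit 's | HStep "'s hist" real 's | HEnd "'s hist" real

primrec hist_space :: "'s primitives \<Rightarrow> nat \<Rightarrow> 's hist topology" where
  "hist_space E 0 = discrete_topology {HInit (init_state E)}"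
| "hist_space E (Suc t) =
     (if t < horizon E
      then transport_topology (\<lambda>(h, c, s). HStep h c s)
             (prod_topology (hist_space E t)
               (prod_topology (cons_space E) (discrete_topology (states_at E (Suc t)))))
      else transport_topology (\<lambda>(h, c). HEnd h c)
             (prod_topology (hist_space E t) (cons_space E)))"

definition hist_extend :: "'s primitives \<Rightarrow> nat \<Rightarrow> 's hist \<Rightarrow> real \<Rightarrow> 's \<Rightarrow> 's hist" where
  "hist_extend E t h c s = (if t < horizon E then HStep h c s else HEnd h c)"

primrec phys_state :: "'s primitives \<Rightarrow> 's hist \<Rightarrow> 's" where
  "phys_state E (HInit s) = s"
| "phys_state E (HStep h c s) = s"
| "phys_state E (HEnd h c) = end_state E"

datatype 's plan = NoPlan | Plan (plan_cons: real) (plan_cont: "'s \<Rightarrow> 's plan")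

text \<open>\<open>plan_space_rem E k\<close> is the space of plans with \<open>k\<close> remaining decision dates.\<close>

primrec plan_space_rem :: "'s primitives \<Rightarrow> nat \<Rightarrow> 's plan topology" where
  "plan_space_rem E 0 = discrete_topology {NoPlan}"
| "plan_space_rem E (Suc k) =
     transport_topology (\<lambda>(c, fp). Plan c fp)
       (prod_topology (cons_space E) (product_topology (\<lambda>_. plan_space_rem E k) (states E)))"

definition plan_space :: "'s primitives \<Rightarrow> nat \<Rightarrow> 's plan topology" where
  "plan_space E t = plan_space_rem E (horizon E + 1 - t)"

text \<open>Elements of \<open>\<real>\<^bsup>S\<^esup>\<close> are extensional functions, equal to \<open>undefined\<close> outside \<open>S\<close>.\<close>

definition sup_dist :: "'s set \<Rightarrow> ('s \<Rightarrow> real) \<Rightarrow> ('s \<Rightarrow> real) \<Rightarrow> real" where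
  "sup_dist S u v = Max ((\<lambda>s. \<bar>u s - v s\<bar>) ` S)"

definition rv_space :: "'s primitives \<Rightarrow> ('s \<Rightarrow> real) topology" where
  "rv_space E = Metric_space.mtopology (states E \<rightarrow>\<^sub>E UNIV) (sup_dist (states E))"

lemma sup_dist_less_iff:
  "finite S \<Longrightarrow> S \<noteq> {} \<Longrightarrow> sup_dist S u v < r \<longleftrightarrow> (\<forall>s\<in>S. \<bar>u s - v s\<bar> < r)"
  by (simp add: sup_dist_def)

lemma Metric_space_sup_dist:
  assumes "finite S" "S \<noteq> {}"
  shows "Metric_space (S \<rightarrow>\<^sub>E UNIV) (sup_dist S)"
proof
  have ge: "\<bar>u s - v s\<bar> \<le> sup_dist S u v" if "s \<in> S" for u v s
    unfolding sup_dist_def using assms that by simp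
  have le: "sup_dist S u v \<le> r \<longleftrightarrow> (\<forall>s\<in>S. \<bar>u s - v s\<bar> \<le> r)" for u v r
    unfolding sup_dist_def using assms by simp
  show nn: "0 \<le> sup_dist S u v" for u v
    using assms ge by (meson abs_ge_zero all_not_in_conv order_trans)
  show "sup_dist S u v = sup_dist S v u" for u v
    by (simp add: sup_dist_def abs_minus_commute)
  show "sup_dist S u v = 0 \<longleftrightarrow> u = v" if "u \<in> S \<rightarrow>\<^sub>E UNIV" "v \<in> S \<rightarrow>\<^sub>E UNIV" for u v
  proof
    assume "sup_dist S u v = 0"
    then have "u s = v s" if "s \<in> S" for s using ge[OF that, of u v] by simp
    then show "u = v" using that by (meson PiE_ext)
  next
    assume "u = v"
    then have "sup_dist S u v \<le> 0" by (simp add: le)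
    then show "sup_dist S u v = 0" using nn[of u v] by simp
  qed
  show "sup_dist S u w \<le> sup_dist S u v + sup_dist S v w" for u v w
    unfolding le
  proof
    fix s assume "s \<in> S"
    then show "\<bar>u s - w s\<bar> \<le> sup_dist S u v + sup_dist S v w"
      using ge[of s u v] ge[of s v w] by linarith
  qed
qed

lemma rv_space_eq_product_topology:
  assumes "valid_primitives E"
  shows "rv_space E = product_topology (\<lambda>_. euclideanreal) (states E)"
proof -
  let ?S = "states E"
  have S: "finite ?S" "?S \<noteq> {}" using assms by (auto simp: valid_primitives_def)
  interpret Metric_space "?S \<rightarrow>\<^sub>E UNIV" "sup_dist ?S" by (rule Metric_space_sup_dist[OF S])
  have mb: "mball u r = (\<Pi>\<^sub>E s\<in>?S. ball (u s) r)" if "u \<in> ?S \<rightarrow>\<^sub>E UNIV" for u r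
    using that by (auto simp: sup_dist_less_iff[OF S] PiE_iff dist_real_def extensional_def)
  have "openin mtopology U \<longleftrightarrow> openin (product_topology (\<lambda>_. euclideanreal) ?S) U" for U
  proof
    assume U: "openin mtopology U"
    show "openin (product_topology (\<lambda>_. euclideanreal) ?S) U"
      unfolding openin_subopen[of _ U]
    proof
      fix u assume u: "u \<in> U"
      then have uS: "u \<in> ?S \<rightarrow>\<^sub>E UNIV" using U openin_mtopology by blast
      obtain r where r: "r > 0" "mball u r \<subseteq> U" using U u openin_mtopology by blast
      have "openin (product_topology (\<lambda>_. euclideanreal) ?S) (mball u r)"
        unfolding mb[OF uS] using S by (simp add: openin_PiE_gen)
      then show "\<exists>T. openin (product_topology (\<lambda>_. euclideanreal) ?S) T \<and> u \<in> T \<and> T \<subseteq> U"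
        using r uS by (intro exI[of _ "mball u r"]) simp
    qed
  next
    assume U: "openin (product_topology (\<lambda>_. euclideanreal) ?S) U"
    show "openin mtopology U"
      unfolding openin_mtopology
    proof (intro conjI allI impI)
      show sub: "U \<subseteq> ?S \<rightarrow>\<^sub>E UNIV" using openin_subset[OF U] by simp
      fix u assume u: "u \<in> U"
      then obtain X where X: "\<forall>s\<in>?S. openin euclideanreal (X s)" "u \<in> Pi\<^sub>E ?S X" "Pi\<^sub>E ?S X \<subseteq> U"
        using U unfolding openin_product_topology_alt by meson
      have "\<exists>r>0. ball (u s) r \<subseteq> X s" if "s \<in> ?S" for s
        using bspec[OF X(1) that, folded open_openin] PiE_mem[OF X(2) that] open_contains_ball by blast
      then obtain r where r: "\<And>s. s \<in> ?S \<Longrightarrow> r s > 0 \<and> ball (u s) (r s) \<subseteq> X s" by metis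
      define q where "q = Min (r ` ?S)"
      have q: "q > 0" "\<And>s. s \<in> ?S \<Longrightarrow> q \<le> r s" using S r by (auto simp: q_def)
      have "mball u q \<subseteq> Pi\<^sub>E ?S X"
        unfolding mb[OF subsetD[OF sub u]]
      proof (rule PiE_mono)
        show "ball (u s) q \<subseteq> X s" if "s \<in> ?S" for s
          using subset_ball[OF q(2)[OF that], of "u s"] r[OF that] by blast
      qed
      then show "\<exists>r>0. mball u r \<subseteq> U" using q(1) X(3) by blast
    qed
  qed
  then show ?thesis unfolding rv_space_def topology_eq by blast
qed

text \<open>\<open>(x, y) \<in> weak_pref P t\<close> means that \<open>x\<close> is weakly preferred to \<open>y\<close> at date \<open>t\<close>.\<close>

record 's grand_preference =
  weak_pref :: "nat \<Rightarrow> ('s hist \<times> 's plan) rel"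
  terminal_pref :: "'s hist \<Rightarrow> real"

definition valid_grand_preference :: "'s primitives \<Rightarrow> 's grand_preference \<Rightarrow> bool" where
  "valid_grand_preference E P \<longleftrightarrow>
     (\<forall>t\<le>horizon E. weak_pref P t \<subseteq>
        (topspace (hist_space E t) \<times> topspace (plan_space E t)) \<times>
        (topspace (hist_space E t) \<times> topspace (plan_space E t))) \<and>
     continuous_map (hist_space E (horizon E + 1)) euclideanreal (terminal_pref P)"

record 's utility_system =
  util :: "nat \<Rightarrow> 's hist \<times> 's plan \<Rightarrow> real"
  terminal_util :: "'s hist \<Rightarrow> real"

definition valid_utility_system :: "'s primitives \<Rightarrow> 's utility_system \<Rightarrow> bool" where
  "valid_utility_system E U \<longleftrightarrow>
     (\<forall>t\<le>horizon E.
        continuous_map (prod_topology (hist_space E t) (plan_space E t)) euclideanreal (util U t)) \<and>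
     continuous_map (hist_space E (horizon E + 1)) euclideanreal (terminal_util U)"

definition compatible :: "'s primitives \<Rightarrow> 's grand_preference \<Rightarrow> 's utility_system \<Rightarrow> bool" where
  "compatible E P U \<longleftrightarrow>
     (\<forall>h \<in> topspace (hist_space E (horizon E + 1)). terminal_util U h = terminal_pref P h) \<and>
     (\<forall>h \<in> topspace (hist_space E (horizon E)). \<forall>f \<in> topspace (plan_space E (horizon E)).
        util U (horizon E) (h, f) =
          terminal_util U (hist_extend E (horizon E) h (plan_cons f) (end_state E))) \<and>
     (\<forall>t\<le>horizon E.
        \<forall>x \<in> topspace (hist_space E t) \<times> topspace (plan_space E t).
        \<forall>y \<in> topspace (hist_space E t) \<times> topspace (plan_space E t).
          util U t x \<ge> util U t y \<longleftrightarrow> (x, y) \<in> weak_pref P t)"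

type_synonym ('s, 'y, 'z) spa_state = "'s \<times> 'y \<times> 'z"

definition proj_s :: "('s, 'y, 'z) spa_state \<Rightarrow> 's" where
  "proj_s = (\<lambda>(s, y, z). s)"

definition proj_sy :: "('s, 'y, 'z) spa_state \<Rightarrow> 's \<times> 'y" where
  "proj_sy = (\<lambda>(s, y, z). (s, y))"

definition proj_sz :: "('s, 'y, 'z) spa_state \<Rightarrow> 's \<times> 'z" where
  "proj_sz = (\<lambda>(s, y, z). (s, z))"

record ('s, 'y, 'z) spa_system =
  y_space :: "nat \<Rightarrow> 'y topology"
  z_space :: "nat \<Rightarrow> 'z topology"
  spa_states :: "nat \<Rightarrow> ('s, 'y, 'z) spa_state set"
  spa_trans :: "nat \<Rightarrow> ('s, 'y, 'z) spa_state \<times> real \<times> 's \<Rightarrow> ('s, 'y, 'z) spa_state"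

definition spa_space ::
  "'s primitives \<Rightarrow> ('s, 'y, 'z) spa_system \<Rightarrow> nat \<Rightarrow> ('s, 'y, 'z) spa_state topology" where
  "spa_space E X t =
     subtopology
       (prod_topology (discrete_topology (states_at E t)) (prod_topology (y_space X t) (z_space X t)))
       (spa_states X t)"

definition spa_y_space ::
  "'s primitives \<Rightarrow> ('s, 'y, 'z) spa_system \<Rightarrow> nat \<Rightarrow> ('s \<times> 'y) topology" where
  "spa_y_space E X t =
     subtopology (prod_topology (discrete_topology (states_at E t)) (y_space X t))
       (proj_sy ` spa_states X t)"

definition spa_z_space ::
  "'s primitives \<Rightarrow> ('s, 'y, 'z) spa_system \<Rightarrow> nat \<Rightarrow> ('s \<times> 'z) topology" where
  "spa_z_space E X t =
     subtopology (prod_topology (discrete_topology (states_at E t)) (z_space X t))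
       (proj_sz ` spa_states X t)"

definition valid_spa_system :: "'s primitives \<Rightarrow> ('s, 'y, 'z) spa_system \<Rightarrow> bool" where
  "valid_spa_system E X \<longleftrightarrow>
     (\<forall>t\<le>horizon E + 1.
        Hausdorff_space (y_space X t) \<and> Hausdorff_space (z_space X t) \<and>
        spa_states X t \<subseteq> states_at E t \<times> topspace (y_space X t) \<times> topspace (z_space X t) \<and>
        spa_states X t \<noteq> {} \<and>
        compact_space (spa_space E X t) \<and> metrizable_space (spa_space E X t)) \<and>
     (\<forall>t\<le>horizon E.
        continuous_map
          (prod_topology (spa_space E X t)
            (prod_topology (cons_space E) (discrete_topology (states_at E (t + 1)))))
          (spa_space E X (t + 1)) (spa_trans X t) \<and>
        (\<forall>\<xi> \<in> spa_states X t. \<forall>c \<in> cons_set E. \<forall>s' \<in> states_at E (t + 1).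
           proj_s (spa_trans X t (\<xi>, c, s')) = s'))"

record ('s, 'y, 'z) spa_structure =
  aggregator :: "nat \<Rightarrow> ('s \<times> 'z) \<times> real \<times> real \<Rightarrow> real"
  cert_equiv :: "nat \<Rightarrow> ('s \<times> 'y) \<times> ('s \<Rightarrow> real) \<Rightarrow> real"
  spa_terminal :: "('s, 'y, 'z) spa_state \<Rightarrow> real"

definition valid_spa_structure ::
  "'s primitives \<Rightarrow> ('s, 'y, 'z) spa_system \<Rightarrow> ('s, 'y, 'z) spa_structure \<Rightarrow> bool" where
  "valid_spa_structure E X V \<longleftrightarrow>
     (\<forall>t<horizon E.
        continuous_map
          (prod_topology (spa_z_space E X t) (prod_topology (cons_space E) euclideanreal))
          euclideanreal (aggregator V t) \<and>
        (\<forall>p \<in> proj_sz ` spa_states X t. \<forall>c \<in> cons_set E. mono (\<lambda>v. aggregator V t (p, c, v))) \<and>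
        continuous_map (prod_topology (spa_y_space E X t) (rv_space E))
          euclideanreal (cert_equiv V t) \<and>
        (\<forall>p \<in> proj_sy ` spa_states X t.
           (\<forall>u \<in> states E \<rightarrow>\<^sub>E UNIV. \<forall>v \<in> states E \<rightarrow>\<^sub>E UNIV.
              (\<forall>s\<in>states E. u s \<le> v s) \<longrightarrow> cert_equiv V t (p, u) \<le> cert_equiv V t (p, v)) \<and>
           (\<forall>v. cert_equiv V t (p, \<lambda>s\<in>states E. v) = v))) \<and>
     continuous_map (spa_space E X (horizon E + 1)) euclideanreal (spa_terminal V)"

text \<open>For \<open>t \<le> horizon E\<close>; at date \<open>horizon E + 1\<close> the utility is \<open>spa_terminal V\<close>.\<close>

function spa_util ::
  "'s primitives \<Rightarrow> ('s, 'y, 'z) spa_system \<Rightarrow> ('s, 'y, 'z) spa_structure \<Rightarrow>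
   nat \<Rightarrow> ('s, 'y, 'z) spa_state \<Rightarrow> 's plan \<Rightarrow> real" where
  "spa_util E X V t \<xi> f =
     (if t < horizon E
      then aggregator V t (proj_sz \<xi>, plan_cons f,
             cert_equiv V t (proj_sy \<xi>,
               \<lambda>s\<in>states E. spa_util E X V (t + 1) (spa_trans X t (\<xi>, plan_cons f, s)) (plan_cont f s)))
      else spa_terminal V (spa_trans X (horizon E) (\<xi>, plan_cons f, end_state E)))"
  by pat_completeness auto
termination
  by (relation "Wellfounded.measure (\<lambda>(E, X, V, t, \<xi>, f). horizon E - t)") auto

declare spa_util.simps [simp del]

definition summary ::
  "'s primitives \<Rightarrow> (nat \<Rightarrow> 's hist \<Rightarrow> 'y) \<Rightarrow> (nat \<Rightarrow> 's hist \<Rightarrow> 'z) \<Rightarrow>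
   nat \<Rightarrow> 's hist \<Rightarrow> ('s, 'y, 'z) spa_state" where
  "summary E \<sigma>y \<sigma>z t h = (phys_state E h, \<sigma>y t h, \<sigma>z t h)"

definition factorizes_via ::
  "'s primitives \<Rightarrow> ('s, 'y, 'z) spa_system \<Rightarrow> ('s, 'y, 'z) spa_structure \<Rightarrow> 's utility_system \<Rightarrow>
   (nat \<Rightarrow> 's hist \<Rightarrow> 'y) \<Rightarrow> (nat \<Rightarrow> 's hist \<Rightarrow> 'z) \<Rightarrow> bool" where
  "factorizes_via E X V U \<sigma>y \<sigma>z \<longleftrightarrow>
     (\<forall>t\<le>horizon E + 1.
        continuous_map (hist_space E t) (y_space X t) (\<sigma>y t) \<and>
        continuous_map (hist_space E t) (z_space X t) (\<sigma>z t) \<and>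
        (\<forall>h \<in> topspace (hist_space E t). summary E \<sigma>y \<sigma>z t h \<in> spa_states X t)) \<and>
     (\<forall>h \<in> topspace (hist_space E (horizon E + 1)).
        terminal_util U h = spa_terminal V (summary E \<sigma>y \<sigma>z (horizon E + 1) h)) \<and>
     (\<forall>t\<le>horizon E. \<forall>h \<in> topspace (hist_space E t). \<forall>f \<in> topspace (plan_space E t).
        util U t (h, f) = spa_util E X V t (summary E \<sigma>y \<sigma>z t h) f) \<and>
     (\<forall>t\<le>horizon E. \<forall>h \<in> topspace (hist_space E t). \<forall>c \<in> cons_set E. \<forall>s \<in> states_at E (t + 1).
        summary E \<sigma>y \<sigma>z (t + 1) (hist_extend E t h c s) = spa_trans X t (summary E \<sigma>y \<sigma>z t h, c, s))"

definition feasible_correspondence ::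
  "'s primitives \<Rightarrow> (nat \<Rightarrow> 's hist \<Rightarrow> real set) \<Rightarrow> bool" where
  "feasible_correspondence E A \<longleftrightarrow>
     (\<forall>t\<le>horizon E. \<forall>h \<in> topspace (hist_space E t). A t h \<subseteq> cons_set E)"

definition separated_markov_feasibility ::
  "'s primitives \<Rightarrow> (nat \<Rightarrow> 's hist \<Rightarrow> 'y) \<Rightarrow> (nat \<Rightarrow> 's hist \<Rightarrow> 'z) \<Rightarrow>
   (nat \<Rightarrow> 's hist \<Rightarrow> real set) \<Rightarrow> bool" where
  "separated_markov_feasibility E \<sigma>y \<sigma>z A \<longleftrightarrow>
     (\<forall>t\<le>horizon E. \<forall>h \<in> topspace (hist_space E t). \<forall>h' \<in> topspace (hist_space E t).
        summary E \<sigma>y \<sigma>z t h = summary E \<sigma>y \<sigma>z t h' \<longrightarrow> A t h = A t h')"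

definition sep_feasible ::
  "'s primitives \<Rightarrow> (nat \<Rightarrow> 's hist \<Rightarrow> 'y) \<Rightarrow> (nat \<Rightarrow> 's hist \<Rightarrow> 'z) \<Rightarrow>
   (nat \<Rightarrow> 's hist \<Rightarrow> real set) \<Rightarrow> nat \<Rightarrow> ('s, 'y, 'z) spa_state \<Rightarrow> real set" where
  "sep_feasible E \<sigma>y \<sigma>z A t \<xi> =
     A t (SOME h. h \<in> topspace (hist_space E t) \<and> summary E \<sigma>y \<sigma>z t h = \<xi>)"

definition upper_hemicontinuous_map ::
  "'a topology \<Rightarrow> 'b topology \<Rightarrow> ('a \<Rightarrow> 'b set) \<Rightarrow> bool" where
  "upper_hemicontinuous_map X Y F \<longleftrightarrow>
     (\<forall>x \<in> topspace X. \<forall>G. openin Y G \<and> F x \<subseteq> G \<longrightarrow>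
        (\<exists>N. openin X N \<and> x \<in> N \<and> (\<forall>x'\<in>N. F x' \<subseteq> G)))"

definition lower_hemicontinuous_map ::
  "'a topology \<Rightarrow> 'b topology \<Rightarrow> ('a \<Rightarrow> 'b set) \<Rightarrow> bool" where
  "lower_hemicontinuous_map X Y F \<longleftrightarrow>
     (\<forall>x \<in> topspace X. \<forall>G. openin Y G \<and> F x \<inter> G \<noteq> {} \<longrightarrow>
        (\<exists>N. openin X N \<and> x \<in> N \<and> (\<forall>x'\<in>N. F x' \<inter> G \<noteq> {})))"

definition separated_DP_regularity ::
  "'s primitives \<Rightarrow> ('s, 'y, 'z) spa_system \<Rightarrow>
   (nat \<Rightarrow> ('s, 'y, 'z) spa_state \<Rightarrow> real set) \<Rightarrow> bool" where
  "separated_DP_regularity E X B \<longleftrightarrow>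
     (\<forall>t\<le>horizon E.
        (\<forall>\<xi> \<in> spa_states X t. B t \<xi> \<noteq> {} \<and> compactin (cons_space E) (B t \<xi>)) \<and>
        upper_hemicontinuous_map (spa_space E X t) (cons_space E) (B t) \<and>
        lower_hemicontinuous_map (spa_space E X t) (cons_space E) (B t))"

definition policies ::
  "'s primitives \<Rightarrow> ('s, 'y, 'z) spa_system \<Rightarrow>
   (nat \<Rightarrow> ('s, 'y, 'z) spa_state \<Rightarrow> real set) \<Rightarrow>
   (nat \<Rightarrow> ('s, 'y, 'z) spa_state \<Rightarrow> real) set" where
  "policies E X B = (\<Pi>\<^sub>E t\<in>{0..horizon E}. \<Pi>\<^sub>E \<xi>\<in>spa_states X t. B t \<xi>)"

text \<open>For \<open>t \<le> horizon E\<close>; at date \<open>horizon E + 1\<close> the utility is \<open>spa_terminal V\<close>.\<close>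

function policy_util ::
  "'s primitives \<Rightarrow> ('s, 'y, 'z) spa_system \<Rightarrow> ('s, 'y, 'z) spa_structure \<Rightarrow>
   (nat \<Rightarrow> ('s, 'y, 'z) spa_state \<Rightarrow> real) \<Rightarrow> nat \<Rightarrow> ('s, 'y, 'z) spa_state \<Rightarrow> real" where
  "policy_util E X V \<pi> t \<xi> =
     (if t < horizon E
      then aggregator V t (proj_sz \<xi>, \<pi> t \<xi>,
             cert_equiv V t (proj_sy \<xi>,
               \<lambda>s\<in>states E. policy_util E X V \<pi> (t + 1) (spa_trans X t (\<xi>, \<pi> t \<xi>, s))))
      else spa_terminal V (spa_trans X (horizon E) (\<xi>, \<pi> (horizon E) \<xi>, end_state E)))"
  by pat_completeness auto
termination
  by (relation "Wellfounded.measure (\<lambda>(E, X, V, \<pi>, t, \<xi>). horizon E - t)") auto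

declare policy_util.simps [simp del]

text \<open>The supremum is taken in the reals, so it is meaningful only for a nonempty set of policies
  whose utilities are bounded above.\<close>

definition value_fn ::
  "'s primitives \<Rightarrow> ('s, 'y, 'z) spa_system \<Rightarrow> ('s, 'y, 'z) spa_structure \<Rightarrow>
   (nat \<Rightarrow> ('s, 'y, 'z) spa_state \<Rightarrow> real set) \<Rightarrow> nat \<Rightarrow> ('s, 'y, 'z) spa_state \<Rightarrow> real" where
  "value_fn E X V B t \<xi> = (SUP \<pi> \<in> policies E X B. policy_util E X V \<pi> t \<xi>)"

definition terminal_objective ::
  "'s primitives \<Rightarrow> ('s, 'y, 'z) spa_system \<Rightarrow> ('s, 'y, 'z) spa_structure \<Rightarrow>
   ('s, 'y, 'z) spa_state \<Rightarrow> real \<Rightarrow> real" where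
  "terminal_objective E X V \<xi> c = spa_terminal V (spa_trans X (horizon E) (\<xi>, c, end_state E))"

definition bellman_objective ::
  "'s primitives \<Rightarrow> ('s, 'y, 'z) spa_system \<Rightarrow> ('s, 'y, 'z) spa_structure \<Rightarrow>
   (nat \<Rightarrow> ('s, 'y, 'z) spa_state \<Rightarrow> real) \<Rightarrow> nat \<Rightarrow> ('s, 'y, 'z) spa_state \<Rightarrow> real \<Rightarrow> real" where
  "bellman_objective E X V J t \<xi> c =
     aggregator V t (proj_sz \<xi>, c,
       cert_equiv V t (proj_sy \<xi>, \<lambda>s\<in>states E. J (t + 1) (spa_trans X t (\<xi>, c, s))))"

definition is_max_value :: "('a \<Rightarrow> real) \<Rightarrow> 'a set \<Rightarrow> real \<Rightarrow> bool" where
  "is_max_value g B m \<longleftrightarrow> (\<exists>c\<in>B. g c = m) \<and> (\<forall>c\<in>B. g c \<le> m)"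

end

theory Submission
  imports Defs
begin

text \<open>By Berge's maximum theorem, backward recursion produces continuous functions whose defining
  maxima are attained at every state. Monotonicity of the aggregator and of the certainty
  equivalent shows by backward induction that these functions dominate every policy utility and
  are reached by the policy of pointwise maximizers, so they are the value functions. Policies are
  arbitrary functions, hence no measurable selection is needed.\<close>

section \<open>Maximum theorem and attainment on compact sets\<close>

text \<open>Each half of hemicontinuity gives one half of continuity. If \<open>a < m x\<close>, a
  maximizer at \<open>x\<close> lies in an open box on which \<open>a < g\<close>, and lower
  hemicontinuity supplies feasible points of that box over nearby \<open>x'\<close>. If
  \<open>m x < a\<close>, the whole slice over \<open>F x\<close> lies in the open set where
  \<open>g < a\<close>, and upper hemicontinuity keeps the nearby slices inside a tube around
  it.\<close>

lemma maximum_theorem: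
  fixes g :: "'a \<times> 'b \<Rightarrow> real"
  assumes g: "continuous_map (prod_topology X Y) euclideanreal g"
    and compact: "\<And>x. x \<in> topspace X \<Longrightarrow> compactin Y (F x)"
    and uhc: "upper_hemicontinuous_map X Y F"
    and lhc: "lower_hemicontinuous_map X Y F"
    and max: "\<And>x. x \<in> topspace X \<Longrightarrow> is_max_value (\<lambda>y. g (x, y)) (F x) (m x)"
  shows "continuous_map X euclideanreal m"
  unfolding continuous_map_upper_lower_semicontinuous_lt
proof (intro conjI allI)
  fix a
  have sub: "F x \<subseteq> topspace Y" if "x \<in> topspace X" for x
    using compactin_subset_topspace[OF compact[OF that]] .
  show "openin X {x \<in> topspace X. a < m x}"
    unfolding openin_subopen[of X "{x \<in> topspace X. a < m x}"]
  proof
    fix x assume "x \<in> {x \<in> topspace X. a < m x}"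
    then have x: "x \<in> topspace X" "a < m x" by auto
    then obtain y where y: "y \<in> F x" "a < g (x, y)"
      using max unfolding is_max_value_def by metis
    have "openin (prod_topology X Y) {p \<in> topspace (prod_topology X Y). a < g p}"
      using g unfolding continuous_map_upper_lower_semicontinuous_lt by blast
    moreover have "(x, y) \<in> {p \<in> topspace (prod_topology X Y). a < g p}"
      using x y sub by auto
    ultimately obtain N G where NG: "openin X N" "openin Y G" "x \<in> N" "y \<in> G"
      "N \<times> G \<subseteq> {p \<in> topspace (prod_topology X Y). a < g p}"
      unfolding openin_prod_topology_alt by meson
    have "F x \<inter> G \<noteq> {}" using y NG by auto
    then obtain N' where N': "openin X N'" "x \<in> N'" "\<forall>x'\<in>N'. F x' \<inter> G \<noteq> {}"
      using lhc x NG(2) unfolding lower_hemicontinuous_map_def by meson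
    have "N \<inter> N' \<subseteq> {x \<in> topspace X. a < m x}"
    proof
      fix x' assume x': "x' \<in> N \<inter> N'"
      then obtain y' where y': "y' \<in> F x'" "y' \<in> G" using N' by auto
      have "x' \<in> topspace X" using x' openin_subset[OF NG(1)] by auto
      moreover have "a < g (x', y')" using x' y' NG(5) by auto
      moreover have "g (x', y') \<le> m x'"
        using max[OF \<open>x' \<in> topspace X\<close>] y' by (auto simp: is_max_value_def)
      ultimately show "x' \<in> {x \<in> topspace X. a < m x}" by auto
    qed
    then show "\<exists>T. openin X T \<and> x \<in> T \<and> T \<subseteq> {x \<in> topspace X. a < m x}"
      using NG N' by (intro exI[of _ "N \<inter> N'"]) auto
  qed
  show "openin X {x \<in> topspace X. m x < a}"
    unfolding openin_subopen[of X "{x \<in> topspace X. m x < a}"]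
  proof
    fix x assume "x \<in> {x \<in> topspace X. m x < a}"
    then have x: "x \<in> topspace X" "m x < a" by auto
    have op: "openin (prod_topology X Y) {p \<in> topspace (prod_topology X Y). g p < a}"
      using g unfolding continuous_map_upper_lower_semicontinuous_lt by blast
    have tube: "{x} \<times> F x \<subseteq> {p \<in> topspace (prod_topology X Y). g p < a}"
      using x sub max[OF x(1)] by (force simp: is_max_value_def)
    \<comment> \<open>Tube lemma: \<open>{x}\<close> and \<open>F x\<close> are compact, so an open
      set containing their product contains an open rectangle around it.\<close>
    have "compactin X {x}" using x(1) by (simp add: compactin_sing)
    from Wallace_theorem_prod_topology[OF this compact[OF x(1)] op tube]
    obtain N G where NG: "openin X N" "openin Y G" "{x} \<subseteq> N" "F x \<subseteq> G"
      "N \<times> G \<subseteq> {p \<in> topspace (prod_topology X Y). g p < a}" .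
    then obtain N' where N': "openin X N'" "x \<in> N'" "\<forall>x'\<in>N'. F x' \<subseteq> G"
      using uhc x unfolding upper_hemicontinuous_map_def by meson
    have "N \<inter> N' \<subseteq> {x \<in> topspace X. m x < a}"
    proof
      fix x' assume x': "x' \<in> N \<inter> N'"
      then have X: "x' \<in> topspace X" using openin_subset[OF NG(1)] by auto
      then obtain y' where y': "y' \<in> F x'" "g (x', y') = m x'"
        using max unfolding is_max_value_def by metis
      then have "(x', y') \<in> N \<times> G" using x' N' by auto
      then show "x' \<in> {x \<in> topspace X. m x < a}" using NG(5) X y' by auto
    qed
    then show "\<exists>T. openin X T \<and> x \<in> T \<and> T \<subseteq> {x \<in> topspace X. m x < a}"
      using NG N' by (intro exI[of _ "N \<inter> N'"]) auto
  qed
qed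

text \<open>Extreme value theorem: the image of \<open>K\<close> is a nonempty compact set of reals.
  This turns the suprema of the recursion below into attained maxima.\<close>

lemma is_max_value_SUP:
  fixes g :: "'a \<Rightarrow> real"
  assumes "continuous_map Y euclideanreal g" "compactin Y K" "K \<noteq> {}"
  shows "is_max_value g K (SUP y\<in>K. g y)"
proof -
  have "compactin euclideanreal (g ` K)" using image_compactin[OF assms(2,1)] .
  then have "compact (g ` K)" by simp
  then obtain m where m: "m \<in> g ` K" "\<forall>x\<in>g ` K. x \<le> m"
    using compact_attains_sup[of "g ` K"] assms(3) by auto
  then have "(SUP y\<in>K. g y) = m" by (intro cSup_eq_maximum) auto
  then show ?thesis using m by (auto simp: is_max_value_def)
qed

section \<open>Backward recursion for the dynamic program\<close>

text \<open>Merging the last date with the earlier ones lets each backward induction run with a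
  single step. Only the next-date function \<open>j\<close> is passed, and the last date ignores
  it.\<close>

definition dp_objective ::
  "'s primitives \<Rightarrow> ('s, 'y, 'z) spa_system \<Rightarrow> ('s, 'y, 'z) spa_structure \<Rightarrow>
   nat \<Rightarrow> (('s, 'y, 'z) spa_state \<Rightarrow> real) \<Rightarrow> ('s, 'y, 'z) spa_state \<Rightarrow> real \<Rightarrow> real" where
  "dp_objective E X V t j \<xi> c =
     (if t < horizon E then bellman_objective E X V (\<lambda>_. j) t \<xi> c else terminal_objective E X V \<xi> c)"

text \<open>The state is bound on the right, so the recursion runs over dates alone and hands on
  whole functions. The inner conditional stops the recursion; its value 0 is a dummy that
  \<open>dp_objective\<close> never reads.\<close>

function dp_value ::
  "'s primitives \<Rightarrow> ('s, 'y, 'z) spa_system \<Rightarrow> ('s, 'y, 'z) spa_structure \<Rightarrow>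
   (nat \<Rightarrow> ('s, 'y, 'z) spa_state \<Rightarrow> real set) \<Rightarrow> nat \<Rightarrow> ('s, 'y, 'z) spa_state \<Rightarrow> real" where
  "dp_value E X V B t =
     (\<lambda>\<xi>. SUP c\<in>B t \<xi>. dp_objective E X V t
        (if t < horizon E then dp_value E X V B (t + 1) else (\<lambda>_. 0)) \<xi> c)"
  by pat_completeness auto
termination
  by (relation "Wellfounded.measure (\<lambda>(E, X, V, B, t). horizon E - t)") auto

declare dp_value.simps [simp del]

text \<open>The continuation enters only through its values at the successors of
  \<open>(\<xi>, c)\<close>. This matters because the functions compared later agree only on SPA
  states.\<close>

lemma dp_objective_cong:
  assumes "\<And>s. t < horizon E \<Longrightarrow> s \<in> states E \<Longrightarrow>
      j (spa_trans X t (\<xi>, c, s)) = j' (spa_trans X t (\<xi>, c, s))"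
  shows "dp_objective E X V t j \<xi> c = dp_objective E X V t j' \<xi> c"
  using assms unfolding dp_objective_def bellman_objective_def
  by (auto intro!: arg_cong[where f = "aggregator V t"] arg_cong[where f = "cert_equiv V t"]
      restrict_ext)

lemma dp_value_eq:
  "dp_value E X V B t \<xi> = (SUP c\<in>B t \<xi>. dp_objective E X V t (dp_value E X V B (t + 1)) \<xi> c)"
  by (subst dp_value.simps) (auto simp: dp_objective_def)

text \<open>The bound on \<open>t\<close> matters: past the horizon \<open>policy_util\<close> still
  evaluates \<open>\<pi>\<close> at date \<open>horizon E\<close>, whereas the right side uses
  \<open>\<pi> t\<close>.\<close>

lemma policy_util_eq:
  assumes "t \<le> horizon E"
  shows "policy_util E X V \<pi> t \<xi> = dp_objective E X V t (policy_util E X V \<pi> (t + 1)) \<xi> (\<pi> t \<xi>)"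
  using assms
  by (subst policy_util.simps)
    (auto simp: dp_objective_def bellman_objective_def terminal_objective_def)

text \<open>The argument takes place on SPA states, with \<open>B\<close> an abstract feasibility
  correspondence there; it is instantiated by \<open>sep_feasible\<close> at the end.\<close>

locale dynamic_program =
  fixes E :: "'s primitives"
    and X :: "('s, 'y, 'z) spa_system"
    and V :: "('s, 'y, 'z) spa_structure"
    and B :: "nat \<Rightarrow> ('s, 'y, 'z) spa_state \<Rightarrow> real set"
  assumes primitives: "valid_primitives E"
    and system: "valid_spa_system E X"
    and recursive_structure: "valid_spa_structure E X V"
    and regular: "separated_DP_regularity E X B"
begin

section \<open>Continuity of the one-step objective\<close>

lemma topspace_spa_space:
  assumes "t \<le> horizon E + 1"
  shows "topspace (spa_space E X t) = spa_states X t"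
  using assms system unfolding valid_spa_system_def spa_space_def
  by (metis inf.absorb2 topspace_discrete_topology topspace_prod_topology topspace_subtopology)

lemma states_at_Suc: "t < horizon E \<Longrightarrow> states_at E (t + 1) = states E"
  by (simp add: states_at_def)

lemma continuous_spa_trans:
  assumes "t \<le> horizon E"
  shows "continuous_map
    (prod_topology (spa_space E X t)
      (prod_topology (cons_space E) (discrete_topology (states_at E (t + 1)))))
    (spa_space E X (t + 1)) (spa_trans X t)"
  using assms system unfolding valid_spa_system_def by blast

lemma topspace_cons_space: "topspace (cons_space E) = cons_set E"
  by (simp add: cons_space_def)

lemma spa_trans_in_states:
  assumes "t \<le> horizon E" "\<xi> \<in> spa_states X t" "c \<in> cons_set E" "s \<in> states_at E (t + 1)"
  shows "spa_trans X t (\<xi>, c, s) \<in> spa_states X (t + 1)"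
proof -
  have "spa_trans X t (\<xi>, c, s) \<in> topspace (spa_space E X (t + 1))"
    using continuous_map_funspace[OF continuous_spa_trans[OF assms(1)]] assms
    by (auto simp: topspace_spa_space topspace_cons_space)
  then show ?thesis using assms(1) by (simp add: topspace_spa_space)
qed

text \<open>Freezing the next state gives the map behind one coordinate of the continuation
  vector.\<close>

lemma continuous_spa_trans_at:
  assumes "t \<le> horizon E" "s \<in> states_at E (t + 1)"
  shows "continuous_map (prod_topology (spa_space E X t) (cons_space E)) (spa_space E X (t + 1))
    (\<lambda>p. spa_trans X t (fst p, snd p, s))"
proof -
  have "continuous_map (prod_topology (spa_space E X t) (cons_space E))
     (prod_topology (spa_space E X t)
      (prod_topology (cons_space E) (discrete_topology (states_at E (t + 1)))))
     (\<lambda>p. (fst p, snd p, s))"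
    using assms by (auto intro!: continuous_map_pairedI continuous_map_fst continuous_map_snd)
  from continuous_map_compose[OF this continuous_spa_trans[OF assms(1)]] show ?thesis
    by (simp add: o_def)
qed

lemma continuous_proj_sy: "continuous_map (spa_space E X t) (spa_y_space E X t) proj_sy"
proof -
  have "continuous_map (prod_topology (discrete_topology (states_at E t))
        (prod_topology (y_space X t) (z_space X t)))
      (prod_topology (discrete_topology (states_at E t)) (y_space X t)) (\<lambda>p. (fst p, fst (snd p)))"
    by (simp add: continuous_map_paired continuous_map_fst
        continuous_map_fst_of[OF continuous_map_snd, unfolded o_def])
  then show ?thesis unfolding spa_space_def spa_y_space_def
    by (auto simp: continuous_map_in_subtopology proj_sy_def case_prod_unfold
        intro: continuous_map_from_subtopology)
qed

lemma continuous_proj_sz: "continuous_map (spa_space E X t) (spa_z_space E X t) proj_sz"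
proof -
  have "continuous_map (prod_topology (discrete_topology (states_at E t))
        (prod_topology (y_space X t) (z_space X t)))
      (prod_topology (discrete_topology (states_at E t)) (z_space X t)) (\<lambda>p. (fst p, snd (snd p)))"
    by (simp add: continuous_map_paired continuous_map_fst
        continuous_map_snd_of[OF continuous_map_snd, unfolded o_def])
  then show ?thesis unfolding spa_space_def spa_z_space_def
    by (auto simp: continuous_map_in_subtopology proj_sz_def case_prod_unfold
        intro: continuous_map_from_subtopology)
qed

text \<open>A composition of the continuous transition, certainty equivalent and aggregator, the
  latter two reached through the projections of the SPA state.\<close>

lemma continuous_bellman_objective:
  assumes t: "t < horizon E"
    and j: "continuous_map (spa_space E X (t + 1)) euclideanreal j"
  shows "continuous_map (prod_topology (spa_space E X t) (cons_space E)) euclideanreal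
    (\<lambda>p. bellman_objective E X V (\<lambda>_. j) t (fst p) (snd p))"
proof -
  let ?P = "prod_topology (spa_space E X t) (cons_space E)"
  let ?u = "\<lambda>p. \<lambda>s\<in>states E. j (spa_trans X t (fst p, snd p, s))"
  have W: "continuous_map
      (prod_topology (spa_z_space E X t) (prod_topology (cons_space E) euclideanreal))
      euclideanreal (aggregator V t)"
    and M: "continuous_map (prod_topology (spa_y_space E X t) (rv_space E))
      euclideanreal (cert_equiv V t)"
    using t recursive_structure unfolding valid_spa_structure_def by blast+
  \<comment> \<open>On finitely many states the sup-norm topology is the product topology, so
    continuity can be checked one coordinate at a time.\<close>
  have u: "continuous_map ?P (rv_space E) ?u"
    unfolding rv_space_eq_product_topology[OF primitives] continuous_map_componentwise
  proof (intro conjI ballI)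
    fix s assume s: "s \<in> states E"
    have "continuous_map ?P (spa_space E X (t + 1)) (\<lambda>p. spa_trans X t (fst p, snd p, s))"
      using t s by (intro continuous_spa_trans_at) (auto simp: states_at_Suc[simplified])
    from continuous_map_compose[OF this j] s
    show "continuous_map ?P euclideanreal (\<lambda>p. ?u p s)" by (simp add: o_def)
  qed auto
  have fst: "continuous_map ?P (spa_space E X t) fst" and snd: "continuous_map ?P (cons_space E) snd"
    by (simp_all add: continuous_map_fst continuous_map_snd)
  have "continuous_map ?P (prod_topology (spa_y_space E X t) (rv_space E)) (\<lambda>p. (proj_sy (fst p), ?u p))"
    using continuous_map_compose[OF fst continuous_proj_sy] u
    by (intro continuous_map_pairedI) (simp_all add: o_def)
  from continuous_map_compose[OF this M]
  have "continuous_map ?P euclideanreal (\<lambda>p. cert_equiv V t (proj_sy (fst p), ?u p))"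
    by (simp add: o_def)
  then have "continuous_map ?P
      (prod_topology (spa_z_space E X t) (prod_topology (cons_space E) euclideanreal))
      (\<lambda>p. (proj_sz (fst p), snd p, cert_equiv V t (proj_sy (fst p), ?u p)))"
    using continuous_map_compose[OF fst continuous_proj_sz] snd
    by (intro continuous_map_pairedI) (simp_all add: o_def)
  from continuous_map_compose[OF this W] show ?thesis
    by (simp add: o_def bellman_objective_def)
qed

lemma continuous_terminal_objective:
  "continuous_map (prod_topology (spa_space E X (horizon E)) (cons_space E)) euclideanreal
    (\<lambda>p. terminal_objective E X V (fst p) (snd p))"
proof -
  have "continuous_map (spa_space E X (horizon E + 1)) euclideanreal (spa_terminal V)"
    using recursive_structure unfolding valid_spa_structure_def by blast
  from continuous_map_compose[OF continuous_spa_trans_at this] show ?thesis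
    by (simp add: o_def terminal_objective_def states_at_def)
qed

lemma continuous_dp_objective:
  assumes "t \<le> horizon E"
    and "t < horizon E \<Longrightarrow> continuous_map (spa_space E X (t + 1)) euclideanreal j"
  shows "continuous_map (prod_topology (spa_space E X t) (cons_space E)) euclideanreal
    (\<lambda>p. dp_objective E X V t j (fst p) (snd p))"
proof (cases "t < horizon E")
  case True
  then show ?thesis using continuous_bellman_objective assms(2) by (simp add: dp_objective_def)
next
  case False
  then have "t = horizon E" using assms(1) by simp
  then show ?thesis using continuous_terminal_objective by (simp add: dp_objective_def)
qed

section \<open>Monotonicity, attained maxima and continuity of the recursion\<close>

lemma feasible_nonempty: "t \<le> horizon E \<Longrightarrow> \<xi> \<in> spa_states X t \<Longrightarrow> B t \<xi> \<noteq> {}"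
  and feasible_compact: "t \<le> horizon E \<Longrightarrow> \<xi> \<in> spa_states X t \<Longrightarrow> compactin (cons_space E) (B t \<xi>)"
  using regular unfolding separated_DP_regularity_def by blast+

lemma feasible_subset:
  assumes "t \<le> horizon E" "\<xi> \<in> spa_states X t"
  shows "B t \<xi> \<subseteq> cons_set E"
  using compactin_subset_topspace[OF feasible_compact[OF assms]] by (simp add: topspace_cons_space)

text \<open>Monotonicity passes first through the certainty equivalent and then through the
  aggregator. Comparing \<open>j\<close> and \<open>j'\<close> on SPA states suffices because
  transitions stay there; at the last date both sides coincide.\<close>

lemma dp_objective_mono:
  assumes "t \<le> horizon E" "\<xi> \<in> spa_states X t" "c \<in> cons_set E"
    and le: "\<And>\<xi>'. t < horizon E \<Longrightarrow> \<xi>' \<in> spa_states X (t + 1) \<Longrightarrow> j \<xi>' \<le> j' \<xi>'"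
  shows "dp_objective E X V t j \<xi> c \<le> dp_objective E X V t j' \<xi> c"
proof (cases "t < horizon E")
  case True
  have "mono (\<lambda>v. aggregator V t (proj_sz \<xi>, c, v))"
    and M: "\<forall>u \<in> states E \<rightarrow>\<^sub>E UNIV. \<forall>v \<in> states E \<rightarrow>\<^sub>E UNIV. (\<forall>s\<in>states E. u s \<le> v s) \<longrightarrow>
      cert_equiv V t (proj_sy \<xi>, u) \<le> cert_equiv V t (proj_sy \<xi>, v)"
    using True assms(2,3) recursive_structure unfolding valid_spa_structure_def by blast+
  moreover have "cert_equiv V t (proj_sy \<xi>, \<lambda>s\<in>states E. j (spa_trans X t (\<xi>, c, s)))
      \<le> cert_equiv V t (proj_sy \<xi>, \<lambda>s\<in>states E. j' (spa_trans X t (\<xi>, c, s)))"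
    using True assms(1-3) le
    by (intro M[rule_format]) (auto simp: states_at_def spa_trans_in_states[simplified])
  ultimately show ?thesis using True by (auto simp: dp_objective_def bellman_objective_def mono_def)
qed (simp add: dp_objective_def)

lemma dp_objective_SUP:
  assumes "t \<le> horizon E" "\<xi> \<in> spa_states X t"
    and "t < horizon E \<Longrightarrow> continuous_map (spa_space E X (t + 1)) euclideanreal j"
  shows "is_max_value (dp_objective E X V t j \<xi>) (B t \<xi>) (SUP c\<in>B t \<xi>. dp_objective E X V t j \<xi> c)"
proof (rule is_max_value_SUP)
  \<comment> \<open>Joint continuity restricts to the slice over the fixed state
    \<open>\<xi>\<close>.\<close>
  have "continuous_map (cons_space E) (prod_topology (spa_space E X t) (cons_space E)) (\<lambda>c. (\<xi>, c))"
    using assms(1,2) by (intro continuous_map_pairedI) (auto simp: topspace_spa_space)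
  from continuous_map_compose[OF this continuous_dp_objective[OF assms(1,3)]]
  show "continuous_map (cons_space E) euclideanreal (dp_objective E X V t j \<xi>)"
    by (simp add: o_def)
qed (use assms feasible_nonempty feasible_compact in auto)

text \<open>Continuity at \<open>t + 1\<close> makes the objective at \<open>t\<close> jointly
  continuous, and the maximum theorem then gives continuity at \<open>t\<close>. At the last date no
  continuation has to be continuous.\<close>

lemma continuous_dp_value:
  assumes "t \<le> horizon E"
  shows "continuous_map (spa_space E X t) euclideanreal (dp_value E X V B t)"
  using assms
proof (induction "horizon E - t" arbitrary: t rule: less_induct)
  case (less t)
  have cont: "continuous_map (spa_space E X (t + 1)) euclideanreal (dp_value E X V B (t + 1))"
    if "t < horizon E"
    using that by (intro less.hyps) auto
  \<comment> \<open>The pairs are left unreduced to match the premise of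
    \<open>maximum_theorem\<close>, whose \<open>g\<close> takes a pair.\<close>
  have max: "is_max_value (\<lambda>c. dp_objective E X V t (dp_value E X V B (t + 1)) (fst (\<xi>, c)) (snd (\<xi>, c)))
      (B t \<xi>) (dp_value E X V B t \<xi>)" if "\<xi> \<in> spa_states X t" for \<xi>
    unfolding dp_value_eq[of E X V B t] using dp_objective_SUP[OF less.prems that cont] by simp
  show ?case
    by (rule maximum_theorem[OF continuous_dp_objective[OF less.prems cont], where F = "B t"])
      (use less.prems regular feasible_compact max
        in \<open>auto simp: topspace_spa_space separated_DP_regularity_def\<close>)
qed

lemma dp_value_is_max:
  assumes "t \<le> horizon E" "\<xi> \<in> spa_states X t"
  shows "is_max_value (dp_objective E X V t (dp_value E X V B (t + 1)) \<xi>) (B t \<xi>)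
    (dp_value E X V B t \<xi>)"
  unfolding dp_value_eq[of E X V B t]
  by (rule dp_objective_SUP[OF assms], rule continuous_dp_value) simp

section \<open>The greedy policy and the comparison of policies\<close>

text \<open>An arbitrary maximizer is chosen at each date and state. The restrictions are there
  because \<open>policies\<close> is a product of extensional functions.\<close>

definition greedy_policy :: "nat \<Rightarrow> ('s, 'y, 'z) spa_state \<Rightarrow> real" where
  "greedy_policy = (\<lambda>t\<in>{0..horizon E}. \<lambda>\<xi>\<in>spa_states X t.
     SOME c. c \<in> B t \<xi> \<and>
       dp_objective E X V t (dp_value E X V B (t + 1)) \<xi> c = dp_value E X V B t \<xi>)"

lemma greedy_policy:
  assumes "t \<le> horizon E" "\<xi> \<in> spa_states X t"
  shows greedy_policy_feasible: "greedy_policy t \<xi> \<in> B t \<xi>"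
    and greedy_policy_optimal: "dp_objective E X V t (dp_value E X V B (t + 1)) \<xi> (greedy_policy t \<xi>)
      = dp_value E X V B t \<xi>"
proof -
  have "\<exists>c. c \<in> B t \<xi> \<and> dp_objective E X V t (dp_value E X V B (t + 1)) \<xi> c = dp_value E X V B t \<xi>"
    using dp_value_is_max[OF assms] unfolding is_max_value_def by blast
  from someI_ex[OF this] assms show "greedy_policy t \<xi> \<in> B t \<xi>"
    "dp_objective E X V t (dp_value E X V B (t + 1)) \<xi> (greedy_policy t \<xi>) = dp_value E X V B t \<xi>"
    by (simp_all add: greedy_policy_def)
qed

lemma greedy_policy_in_policies: "greedy_policy \<in> policies E X B"
  unfolding policies_def
proof (intro PiE_I)
  fix t \<xi> assume "t \<in> {0..horizon E}" "\<xi> \<in> spa_states X t"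
  then show "greedy_policy t \<xi> \<in> B t \<xi>" by (simp add: greedy_policy_feasible)
qed (auto simp: greedy_policy_def)

lemma policy_feasible:
  assumes "\<pi> \<in> policies E X B" "t \<le> horizon E" "\<xi> \<in> spa_states X t"
  shows "\<pi> t \<xi> \<in> B t \<xi>"
  using assms unfolding policies_def by (meson PiE_mem atLeastAtMost_iff zero_le)

text \<open>Backward induction: the bound at \<open>t + 1\<close> lifts to date \<open>t\<close> by
  monotonicity of the objective, and the level chosen by \<open>\<pi>\<close> cannot beat the
  maximum over feasible levels.\<close>

lemma policy_util_le_dp_value:
  assumes "\<pi> \<in> policies E X B" "t \<le> horizon E" "\<xi> \<in> spa_states X t"
  shows "policy_util E X V \<pi> t \<xi> \<le> dp_value E X V B t \<xi>"
  using assms(2,3)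
proof (induction "horizon E - t" arbitrary: t \<xi> rule: less_induct)
  case (less t \<xi>)
  have feas: "\<pi> t \<xi> \<in> B t \<xi>" using policy_feasible assms(1) less.prems .
  have "policy_util E X V \<pi> t \<xi> = dp_objective E X V t (policy_util E X V \<pi> (t + 1)) \<xi> (\<pi> t \<xi>)"
    using policy_util_eq[OF less.prems(1)] .
  also have "\<dots> \<le> dp_objective E X V t (dp_value E X V B (t + 1)) \<xi> (\<pi> t \<xi>)"
    using less feas feasible_subset[OF less.prems] by (intro dp_objective_mono) auto
  also have "\<dots> \<le> dp_value E X V B t \<xi>"
    using dp_value_is_max[OF less.prems] feas by (simp add: is_max_value_def)
  finally show ?case .
qed

text \<open>Backward induction: at the successors the policy already earns \<open>dp_value\<close>,
  and its choice at \<open>t\<close> attains the maximum for that continuation. The hypothesis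
  covers SPA states only, hence the appeal to \<open>dp_objective_cong\<close>.\<close>

lemma policy_util_greedy_policy:
  assumes "t \<le> horizon E" "\<xi> \<in> spa_states X t"
  shows "policy_util E X V greedy_policy t \<xi> = dp_value E X V B t \<xi>"
  using assms
proof (induction "horizon E - t" arbitrary: t \<xi> rule: less_induct)
  case (less t \<xi>)
  have c: "greedy_policy t \<xi> \<in> cons_set E"
    using greedy_policy_feasible[OF less.prems] feasible_subset[OF less.prems] by blast
  have "dp_objective E X V t (policy_util E X V greedy_policy (t + 1)) \<xi> (greedy_policy t \<xi>)
      = dp_objective E X V t (dp_value E X V B (t + 1)) \<xi> (greedy_policy t \<xi>)"
    using less.prems c spa_trans_in_states[OF less.prems c]
    by (intro dp_objective_cong less.hyps) (auto simp: states_at_def)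
  then show ?case
    using policy_util_eq[OF less.prems(1)] greedy_policy_optimal[OF less.prems] by metis
qed

section \<open>Identification of the value functions\<close>

lemma bdd_above_policy_util:
  assumes "t \<le> horizon E" "\<xi> \<in> spa_states X t"
  shows "bdd_above ((\<lambda>\<pi>. policy_util E X V \<pi> t \<xi>) ` policies E X B)"
  by (rule bdd_aboveI2) (rule policy_util_le_dp_value[OF _ assms])

text \<open>The recursive value is an upper bound of the policy utilities that
  \<open>greedy_policy\<close> reaches, hence their maximum and supremum.\<close>

lemma value_fn_eq_dp_value:
  assumes "t \<le> horizon E" "\<xi> \<in> spa_states X t"
  shows "value_fn E X V B t \<xi> = dp_value E X V B t \<xi>"
  unfolding value_fn_def
proof (rule cSup_eq_maximum)
  show "dp_value E X V B t \<xi> \<in> (\<lambda>\<pi>. policy_util E X V \<pi> t \<xi>) ` policies E X B"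
    using policy_util_greedy_policy[OF assms, symmetric] greedy_policy_in_policies
    by (rule image_eqI)
  fix v assume "v \<in> (\<lambda>\<pi>. policy_util E X V \<pi> t \<xi>) ` policies E X B"
  then obtain \<pi> where "\<pi> \<in> policies E X B" "v = policy_util E X V \<pi> t \<xi>" by (rule imageE)
  then show "v \<le> dp_value E X V B t \<xi>" using policy_util_le_dp_value[OF _ assms] by simp
qed

text \<open>Successors under levels in \<open>cons_set E\<close> are SPA states, where the two
  continuations agree. At the last date the continuation is not read, so the values of
  \<open>value_fn\<close> past the horizon do not matter.\<close>

lemma dp_objective_value_fn:
  assumes "t \<le> horizon E" "\<xi> \<in> spa_states X t" "c \<in> cons_set E"
  shows "dp_objective E X V t (value_fn E X V B (t + 1)) \<xi> c
    = dp_objective E X V t (dp_value E X V B (t + 1)) \<xi> c"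
  using spa_trans_in_states[OF assms]
  by (intro dp_objective_cong value_fn_eq_dp_value) (auto simp: states_at_def)

lemma continuous_value_fn:
  assumes "t \<le> horizon E"
  shows "continuous_map (spa_space E X t) euclideanreal (value_fn E X V B t)"
proof (rule continuous_map_eq[OF continuous_dp_value[OF assms]])
  fix \<xi> assume "\<xi> \<in> topspace (spa_space E X t)"
  then show "dp_value E X V B t \<xi> = value_fn E X V B t \<xi>"
    using assms by (simp add: topspace_spa_space value_fn_eq_dp_value)
qed

text \<open>The Bellman equation, inherited from the recursion because the two objectives agree on
  feasible levels.\<close>

lemma value_fn_is_max:
  assumes "t \<le> horizon E" "\<xi> \<in> spa_states X t"
  shows "is_max_value (dp_objective E X V t (value_fn E X V B (t + 1)) \<xi>) (B t \<xi>)
    (value_fn E X V B t \<xi>)"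
proof -
  have "dp_objective E X V t (value_fn E X V B (t + 1)) \<xi> c
      = dp_objective E X V t (dp_value E X V B (t + 1)) \<xi> c" if "c \<in> B t \<xi>" for c
    using dp_objective_value_fn[OF assms] feasible_subset[OF assms] that by blast
  then show ?thesis
    using dp_value_is_max[OF assms] unfolding is_max_value_def value_fn_eq_dp_value[OF assms]
    by (metis (no_types))
qed

lemma greedy_policy_is_arg_max:
  assumes "t \<le> horizon E" "\<xi> \<in> spa_states X t"
  shows "is_arg_max (dp_objective E X V t (value_fn E X V B (t + 1)) \<xi>) (\<lambda>c. c \<in> B t \<xi>)
    (greedy_policy t \<xi>)"
proof -
  have "dp_objective E X V t (value_fn E X V B (t + 1)) \<xi> (greedy_policy t \<xi>) = value_fn E X V B t \<xi>"
    using greedy_policy[OF assms] feasible_subset[OF assms]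
    by (subst dp_objective_value_fn[OF assms]) (auto simp: value_fn_eq_dp_value[OF assms])
  then show ?thesis
    using value_fn_is_max[OF assms] greedy_policy_feasible[OF assms]
    by (simp add: is_arg_max_linorder is_max_value_def)
qed

end

section \<open>Return to the separate terminal and Bellman objectives\<close>

lemma bellman_objective_eq_dp_objective:
  "t < horizon E \<Longrightarrow> bellman_objective E X V J t = dp_objective E X V t (J (t + 1))"
  by (simp add: fun_eq_iff dp_objective_def bellman_objective_def)

text \<open>The free \<open>j\<close> allows any continuation past the horizon, so the terminal case
  can take the shape of the general one.\<close>

lemma terminal_objective_eq_dp_objective:
  "terminal_objective E X V = dp_objective E X V (horizon E) j"
  by (simp add: fun_eq_iff dp_objective_def)

text \<open>The boundedness conjunct, together with the existence of a policy, certifies that the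
  real-valued \<open>SUP\<close> in \<open>value_fn\<close> is a genuine supremum. The policy is
  quantified before dates and states, so one policy serves all of them.\<close>

theorem corollary6p19:
  fixes E :: "'s primitives"
    and P :: "'s grand_preference"
    and U :: "'s utility_system"
    and X :: "('s, 'y, 'z) spa_system"
    and V :: "('s, 'y, 'z) spa_structure"
    and \<sigma>y :: "nat \<Rightarrow> 's hist \<Rightarrow> 'y"
    and \<sigma>z :: "nat \<Rightarrow> 's hist \<Rightarrow> 'z"
    and A :: "nat \<Rightarrow> 's hist \<Rightarrow> real set"
  assumes "valid_primitives E"
    and "valid_grand_preference E P"
    and "valid_utility_system E U"
    and "compatible E P U"
    and "valid_spa_system E X"
    and "valid_spa_structure E X V"
    and "factorizes_via E X V U \<sigma>y \<sigma>z"
    and "\<forall>t\<le>horizon E + 1. summary E \<sigma>y \<sigma>z t ` topspace (hist_space E t) = spa_states X t"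
    and "feasible_correspondence E A"
    and "separated_markov_feasibility E \<sigma>y \<sigma>z A"
    and "separated_DP_regularity E X (sep_feasible E \<sigma>y \<sigma>z A)"
  shows "let T = horizon E; B = sep_feasible E \<sigma>y \<sigma>z A; J = value_fn E X V B in
     (\<forall>t\<le>T. \<forall>\<xi> \<in> spa_states X t.
        bdd_above ((\<lambda>\<pi>. policy_util E X V \<pi> t \<xi>) ` policies E X B)) \<and>
     (\<forall>\<xi> \<in> spa_states X T. is_max_value (terminal_objective E X V \<xi>) (B T \<xi>) (J T \<xi>)) \<and>
     (\<forall>t<T. \<forall>\<xi> \<in> spa_states X t.
        is_max_value (bellman_objective E X V J t \<xi>) (B t \<xi>) (J t \<xi>)) \<and>
     (\<exists>\<pi> \<in> policies E X B.
        (\<forall>\<xi> \<in> spa_states X T. is_arg_max (terminal_objective E X V \<xi>) (\<lambda>c. c \<in> B T \<xi>) (\<pi> T \<xi>)) \<and>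
        (\<forall>t<T. \<forall>\<xi> \<in> spa_states X t.
           is_arg_max (bellman_objective E X V J t \<xi>) (\<lambda>c. c \<in> B t \<xi>) (\<pi> t \<xi>)) \<and>
        (\<forall>t\<le>T. \<forall>\<xi> \<in> spa_states X t. policy_util E X V \<pi> t \<xi> = J t \<xi>)) \<and>
     (\<forall>t\<le>T. continuous_map (spa_space E X t) euclideanreal (J t))"
proof -
  let ?B = "sep_feasible E \<sigma>y \<sigma>z A"
  let ?J = "value_fn E X V ?B"
  interpret dynamic_program E X V ?B
    using assms(1,5,6,11) by (rule dynamic_program.intro)
  \<comment> \<open>The continuation is chosen as \<open>?J (horizon E + 1)\<close> so that
    \<open>value_fn_is_max\<close> and \<open>greedy_policy_is_arg_max\<close> apply verbatim at the
    last date.\<close>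
  have terminal: "terminal_objective E X V = dp_objective E X V (horizon E) (?J (horizon E + 1))"
    by (rule terminal_objective_eq_dp_objective)
  have bellman: "bellman_objective E X V ?J t = dp_objective E X V t (?J (t + 1))"
    if "t < horizon E" for t
    using that by (rule bellman_objective_eq_dp_objective)
  show ?thesis
    unfolding Let_def
  proof (intro conjI bexI[of _ greedy_policy] ballI allI impI)
    show "is_max_value (terminal_objective E X V \<xi>) (?B (horizon E) \<xi>) (?J (horizon E) \<xi>)"
      and "is_arg_max (terminal_objective E X V \<xi>) (\<lambda>c. c \<in> ?B (horizon E) \<xi>)
        (greedy_policy (horizon E) \<xi>)"
      if "\<xi> \<in> spa_states X (horizon E)" for \<xi>
      unfolding terminal using that by (simp_all only: order_refl value_fn_is_max greedy_policy_is_arg_max)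
    show "is_max_value (bellman_objective E X V ?J t \<xi>) (?B t \<xi>) (?J t \<xi>)"
      and "is_arg_max (bellman_objective E X V ?J t \<xi>) (\<lambda>c. c \<in> ?B t \<xi>) (greedy_policy t \<xi>)"
      if "t < horizon E" "\<xi> \<in> spa_states X t" for t \<xi>
      unfolding bellman[OF that(1)]
      using that by (simp_all only: less_imp_le value_fn_is_max greedy_policy_is_arg_max)
    show "policy_util E X V greedy_policy t \<xi> = ?J t \<xi>"
      if "t \<le> horizon E" "\<xi> \<in> spa_states X t" for t \<xi>
      using that by (simp add: policy_util_greedy_policy value_fn_eq_dp_value)
  qed (simp_all add: bdd_above_policy_util continuous_value_fn greedy_policy_in_policies)
qed

end
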